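(* Let $\mathbb{F}$ be a field with characteristic $p$ (with the convention $p=\infty$ if the identity has infinite additive order), and let $A$ and $B$ be finite nonempty subsets of $\mathbb{F}$. Let $S$ be a finite nonempty subset of $\mathbb{F}^{\times}\times\mathbb{F}$. Then $$|\{a+b : a\in A,\ b\in B,\ \text{and}\ a+ub\neq v\ \text{for all}\ \langle u,v\rangle\in S\}|\ge\min\{p-|\{v\in\mathbb{F}:\langle 1,v\rangle\in S\}|,\ |A|+|B|-2|S|-1\}.$$
   Context: The characteristic of a field $\mathbb{F}$ is defined here as the additive order of its multiplicative identity; it is either a prime or $\infty$ (so $p=\infty$ corresponds to what is usually called characteristic $0$, and then $p$ minus any integer is $\infty$). $\mathbb{F}^{\times}=\mathbb{F}\setminus\{0\}$, and $\langle u,v\rangle$ denotes an ordered pair. *)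

theory Defs
  imports Complex_Main "HOL-Library.Extended_Real"
begin

text \<open>
  The characteristic as the additive order of the identity. The library's \<open>CHAR('a)\<close> is that
  order when it is finite, and \<open>0\<close> when it is infinite. Values are extended reals, so that
  subtracting an integer from \<open>\<infinity>\<close> gives \<open>\<infinity>\<close>, and subtraction from a finite characteristic
  is not truncated.
\<close>

definition field_char :: "'a::field itself \<Rightarrow> ereal" where
  "field_char _ = (if CHAR('a) = 0 then \<infinity> else ereal (real CHAR('a)))"

end

theory Submission
  imports Defs "HOL-Computational_Algebra.Polynomial"
begin

text \<open>
  The proof is by the polynomial method. Write \<open>C\<close> for the set of restricted sums and adjoin to
  \<open>S\<close> the pairs \<open>(1, c)\<close> with \<open>c \<in> C\<close>; let \<open>T\<close> be the result. Then
  \<open>\<Prod>(u,v)\<in>T. (x + u y - v)\<close> vanishes on all of \<open>A \<times> B\<close>: a point where the factors from \<open>S\<close> are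
  nonzero has its sum in \<open>C\<close>. The union is disjoint, since a sum in \<open>C\<close> avoids every \<open>v\<close>
  with \<open>(1, v) \<in> S\<close>, so the product has degree \<open>d = |S| + |C|\<close>.

  By the Combinatorial Nullstellensatz (here \<open>exists_point_avoiding_lines\<close>), the
  coefficient of \<open>x\<^sup>i y\<^sup>d\<^sup>-\<^sup>i\<close> must vanish whenever \<open>i < |A|\<close> and \<open>d - i < |B|\<close>. These coefficients
  are the ones of the univariate polynomial \<open>Q = \<Prod>(u,v)\<in>T. (x + u)\<close>, and the
  vanishing range is a window of \<open>|A| + |B| - 1 - d\<close> consecutive indices. As all \<open>u\<close> are nonzero,
  the two extreme coefficients of \<open>Q\<close> are nonzero, so the window lies strictly inside
  \<open>{0..d}\<close>. If \<open>|C| < |A| + |B| - 2|S| - 1\<close>, this leaves \<open>Q\<close> with at most \<open>|C|\<close> nonzero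
  coefficients.

  On the other hand \<open>-1\<close> is a root of \<open>Q\<close> of multiplicity exactly \<open>M = |C| + |{v. (1, v) \<in> S}|\<close>, and
  if \<open>M < p\<close> a polynomial with a nonzero root of multiplicity \<open>M\<close> has more than \<open>M\<close> nonzero
  coefficients (\<open>card_support_gt_multiplicity\<close>). So \<open>|C|\<close> cannot be below both bounds.
\<close>

section \<open>Sparse polynomials have no nonzero roots of high multiplicity\<close>

text \<open>
  This is the rule of Descartes type due to Hajos, valid while the multiplicity is below the
  characteristic. Removing a power of \<open>x\<close> makes the constant term nonzero without changing the
  number of terms; differentiating then loses at least that term and lowers the multiplicity by
  exactly one.
\<close>

lemma card_support_gt_multiplicity:
  fixes R :: "'a::field poly"
  assumes "c \<noteq> 0" "poly R c \<noteq> 0" "CHAR('a) = 0 \<or> n < CHAR('a)"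
  shows "n < card {i. coeff ([:- c, 1:] ^ n * R) i \<noteq> 0}"
  using assms(2,3)
proof (induction n arbitrary: R)
  case 0
  then have "lead_coeff R \<noteq> 0" by auto
  then have "{i. coeff R i \<noteq> 0} \<noteq> {}" by blast
  moreover have "finite {i. coeff R i \<noteq> 0}"
    using MOST_coeff_eq_0[of R] by (simp add: MOST_iff_cofinite)
  ultimately show ?case
    by (simp add: card_gt_0_iff)
next
  case (Suc n)
  define r where "r = order 0 R"
  from Suc.prems(1) have "R \<noteq> 0" by auto
  then obtain R' where R': "R = [:- 0, 1:] ^ r * R'" "\<not> [:- 0, 1:] dvd R'"
    using order_decomp[of R 0] by (auto simp: r_def)
  have R'0: "poly R' 0 \<noteq> 0" using R'(2) by (simp add: poly_eq_0_iff_dvd)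
  have R'c: "poly R' c \<noteq> 0" using Suc.prems(1) R'(1) by auto
  define P where "P = [:- c, 1:] ^ Suc n * R'"
  have shift: "[:- c, 1:] ^ Suc n * R = monom 1 r * P"
    by (simp add: P_def R'(1) monom_altdef algebra_simps del: power_Suc)
  have fin: "finite {i. coeff P i \<noteq> 0}" for P :: "'a poly"
    using MOST_coeff_eq_0[of P] by (simp add: MOST_iff_cofinite)
  have "card {i. coeff P i \<noteq> 0} = card ((+) r ` {i. coeff P i \<noteq> 0})"
    by (simp add: card_image)
  also have "\<dots> \<le> card {i. coeff (monom 1 r * P) i \<noteq> 0}"
    by (rule card_mono[OF fin]) (auto simp: coeff_monom_mult)
  finally have le1: "card {i. coeff P i \<noteq> 0} \<le> card {i. coeff ([:- c, 1:] ^ Suc n * R) i \<noteq> 0}"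
    by (simp only: shift)
  define R'' where "R'' = smult (of_nat (Suc n)) R' + [:- c, 1:] * pderiv R'"
  have deriv: "pderiv P = [:- c, 1:] ^ n * R''"
    unfolding P_def R''_def pderiv_mult pderiv_power_Suc
    by (simp add: pderiv_pCons algebra_simps)
  have "of_nat (Suc n) \<noteq> (0::'a)"
    using Suc.prems(2) by (auto simp: of_nat_eq_0_iff_char_dvd simp del: of_nat_Suc dest: dvd_imp_le)
  then have "poly R'' c \<noteq> 0"
    using R'c by (simp add: R''_def del: of_nat_Suc)
  with Suc have "Suc n \<le> card {i. coeff (pderiv P) i \<noteq> 0}"
    by (auto simp: deriv Suc_le_eq)
  also have "\<dots> = card (Suc ` {i. coeff (pderiv P) i \<noteq> 0})"
    by (simp add: card_image)
  also have "\<dots> < card {i. coeff P i \<noteq> 0}"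
  proof (rule psubset_card_mono[OF fin])
    have "coeff P 0 \<noteq> 0"
      using R'0 \<open>c \<noteq> 0\<close> by (simp add: P_def flip: poly_0_coeff_0)
    then show "Suc ` {i. coeff (pderiv P) i \<noteq> 0} \<subset> {i. coeff P i \<noteq> 0}"
      by (auto simp: coeff_pderiv)
  qed
  finally show ?case using le1 by linarith
qed

section \<open>The Combinatorial Nullstellensatz for products of lines\<close>

text \<open>
  The functional \<open>f \<mapsto> (\<Sum>x\<in>X. w x * f x)\<close> is the divided difference of \<open>f\<close> at \<open>X\<close>, which reads off
  the top coefficient of a polynomial of degree at most \<open>t\<close>. Adjoining a point \<open>z\<close> replaces \<open>f\<close>
  by \<open>(f x - f z) / (x - z)\<close>.
\<close>

lemma exists_top_coeff_weights:
  fixes X :: "'a::field set"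
  assumes "finite X" "card X = Suc t"
  shows "\<exists>w. \<forall>i\<le>t. (\<Sum>x\<in>X. w x * x ^ i) = (if i = t then 1 else 0)"
  using assms
proof (induction t arbitrary: X)
  case 0
  then obtain x where "X = {x}" by (auto simp: card_1_singleton_iff)
  then show ?case by (intro exI[of _ "\<lambda>_. 1"]) simp
next
  case (Suc t)
  then obtain z Y where X: "X = insert z Y" "z \<notin> Y" "card Y = Suc t" "finite Y"
    by (metis card_Suc_eq_finite)
  with Suc.IH obtain w where w: "\<And>i. i \<le> t \<Longrightarrow> (\<Sum>x\<in>Y. w x * x ^ i) = (if i = t then 1 else 0)"
    by blast
  define w' where "w' x = (if x = z then - (\<Sum>y\<in>Y. w y / (y - z)) else w x / (x - z))" for x
  have "(\<Sum>x\<in>X. w' x * x ^ i) = (if i = Suc t then 1 else 0)" if "i \<le> Suc t" for i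
  proof -
    have "(\<Sum>x\<in>X. w' x * x ^ i) = w' z * z ^ i + (\<Sum>x\<in>Y. w' x * x ^ i)"
      using X by simp
    also have "(\<Sum>x\<in>Y. w' x * x ^ i) = (\<Sum>x\<in>Y. w x / (x - z) * x ^ i)"
      using X by (intro sum.cong) (auto simp: w'_def)
    also have "w' z * z ^ i + \<dots> = (\<Sum>x\<in>Y. w x / (x - z) * (x ^ i - z ^ i))"
      by (simp add: w'_def sum_distrib_right sum_subtractf right_diff_distrib)
    also have "\<dots> = (\<Sum>x\<in>Y. \<Sum>j<i. z ^ (i - Suc j) * (w x * x ^ j))"
    proof (intro sum.cong refl)
      fix x assume "x \<in> Y"
      with X have "x - z \<noteq> 0" by auto
      then have "w x / (x - z) * (x ^ i - z ^ i) = w x * (\<Sum>j<i. z ^ (i - Suc j) * x ^ j)"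
        unfolding power_diff_sumr2 by simp
      then show "w x / (x - z) * (x ^ i - z ^ i) = (\<Sum>j<i. z ^ (i - Suc j) * (w x * x ^ j))"
        by (simp add: sum_distrib_left mult.left_commute)
    qed
    also have "\<dots> = (\<Sum>j<i. z ^ (i - Suc j) * (\<Sum>x\<in>Y. w x * x ^ j))"
      by (subst sum.swap) (simp add: sum_distrib_left)
    also have "\<dots> = (\<Sum>j<i. z ^ (i - Suc j) * (if j = t then 1 else 0))"
      using that by (intro sum.cong) (auto simp: w)
    also have "\<dots> = (if i = Suc t then 1 else 0)"
      using that by (auto simp: if_distrib cong: if_cong)
    finally show ?thesis .
  qed
  then show ?case by blast
qed

text \<open>
  The product of two such functionals extracts the coefficient of \<open>x\<^sup>s y\<^sup>t\<close> from a
  bivariate polynomial of total degree at most \<open>s + t\<close>. The leading monomial \<open>x\<^sup>i y\<^sup>j\<close> and the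
  case of small degree are carried along so that the factors can be multiplied out one by one: the
  terms \<open>x\<close> and \<open>u y\<close> raise \<open>i\<close> and \<open>j\<close>, while the term \<open>v\<close> leads to small degree.
\<close>

lemma top_coeff_prod_lines:
  fixes X Y :: "'a::field set"
  assumes wX: "\<And>i. i \<le> s \<Longrightarrow> (\<Sum>x\<in>X. wX x * x ^ i) = (if i = s then 1 else 0)"
    and wY: "\<And>i. i \<le> t \<Longrightarrow> (\<Sum>y\<in>Y. wY y * y ^ i) = (if i = t then 1 else 0)"
    and "finite T" "i + j + card T \<le> s + t"
  shows "(\<Sum>x\<in>X. \<Sum>y\<in>Y. wX x * wY y * (x ^ i * y ^ j * (\<Prod>(u,v)\<in>T. x + u * y - v)))
    = (if i + j + card T = s + t then coeff (monom 1 i * (\<Prod>(u,v)\<in>T. [:u, 1:])) s else 0)"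
  using assms(3,4)
proof (induction T arbitrary: i j rule: finite_induct)
  case empty
  have "(\<Sum>x\<in>X. \<Sum>y\<in>Y. wX x * wY y * (x ^ i * y ^ j))
      = (\<Sum>x\<in>X. wX x * x ^ i) * (\<Sum>y\<in>Y. wY y * y ^ j)"
    by (simp add: sum_product algebra_simps)
  also have "\<dots> = (if i + j = s + t then coeff (monom 1 i) s else 0)"
  proof (cases "i = s \<and> j = t")
    case False
    with empty.prems have "i < s \<or> j < t" by auto
    with False show ?thesis by (auto simp: wX wY)
  qed (simp add: wX wY)
  finally show ?case by simp
next
  case (insert p T)
  obtain u v where p: "p = (u, v)" by (cases p)
  define F where "F x y = (\<Prod>(u,v)\<in>T. x + u * y - v)" for x y :: 'a
  define L where "L i j = (\<Sum>x\<in>X. \<Sum>y\<in>Y. wX x * wY y * (x ^ i * y ^ j * F x y))" for i j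
  define Q where "Q = (\<Prod>(u,v)\<in>T. [:u, 1:])"
  have L: "L i j = (if i + j + card T = s + t then coeff (monom 1 i * Q) s else 0)"
    if "i + j + card T \<le> s + t" for i j
    using insert.IH[OF that] by (simp only: L_def F_def Q_def)
  have prod: "(\<Prod>(u,v)\<in>insert p T. x + u * y - v) = (x + u * y - v) * F x y" for x y
    using insert.hyps by (simp add: F_def p)
  have "(\<Sum>x\<in>X. \<Sum>y\<in>Y. wX x * wY y * (x ^ i * y ^ j * (\<Prod>(u,v)\<in>insert p T. x + u * y - v)))
      = (\<Sum>x\<in>X. \<Sum>y\<in>Y. wX x * wY y * (x ^ Suc i * y ^ j * F x y)
          + u * (wX x * wY y * (x ^ i * y ^ Suc j * F x y))
          - v * (wX x * wY y * (x ^ i * y ^ j * F x y)))"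
    unfolding prod by (simp add: algebra_simps)
  also have "\<dots> = L (Suc i) j + u * L i (Suc j) - v * L i j"
    by (simp only: L_def sum.distrib sum_subtractf sum_distrib_left)
  also have "\<dots> = (if i + j + card (insert p T) = s + t
      then coeff (monom 1 (Suc i) * Q) s + u * coeff (monom 1 i * Q) s else 0)"
    using insert.prems insert.hyps by (simp add: L)
  also have "coeff (monom 1 (Suc i) * Q) s + u * coeff (monom 1 i * Q) s
      = coeff (monom 1 i * (\<Prod>(u,v)\<in>insert p T. [:u, 1:])) s"
    using insert.hyps
    by (simp add: Q_def[symmetric] p monom_Suc mult_pCons_left mult_pCons_right algebra_simps)
  finally show ?case .
qed

text \<open>
  On subgrids of the exact sizes \<open>s + 1\<close> and \<open>t + 1\<close> the weighted sum of the product of the lines is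
  the given coefficient, so the product cannot vanish at every point of the subgrid.
\<close>

lemma exists_point_avoiding_lines:
  fixes X Y :: "'a::field set"
  assumes "finite T" "card T = s + t" "s < card X" "t < card Y"
    and "coeff (\<Prod>(u,v)\<in>T. [:u, 1:]) s \<noteq> 0"
  shows "\<exists>x\<in>X. \<exists>y\<in>Y. \<forall>(u,v)\<in>T. x + u * y \<noteq> v"
proof -
  obtain X' Y' where X': "X' \<subseteq> X" "card X' = Suc s" "finite X'"
    and Y': "Y' \<subseteq> Y" "card Y' = Suc t" "finite Y'"
    using assms(3,4) by (metis Suc_leI obtain_subset_with_card_n)
  obtain wX wY where "\<And>i. i \<le> s \<Longrightarrow> (\<Sum>x\<in>X'. wX x * x ^ i) = (if i = s then 1 else 0)"
    and "\<And>i. i \<le> t \<Longrightarrow> (\<Sum>y\<in>Y'. wY y * y ^ i) = (if i = t then 1 else 0)"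
    using exists_top_coeff_weights[OF X'(3,2)] exists_top_coeff_weights[OF Y'(3,2)] by metis
  from top_coeff_prod_lines[OF this assms(1), where i = 0 and j = 0]
  have "(\<Sum>x\<in>X'. \<Sum>y\<in>Y'. wX x * wY y * (\<Prod>(u,v)\<in>T. x + u * y - v)) \<noteq> 0"
    using assms(2,5) by simp
  then obtain x where x: "x \<in> X'" "(\<Sum>y\<in>Y'. wX x * wY y * (\<Prod>(u,v)\<in>T. x + u * y - v)) \<noteq> 0"
    by (meson sum.not_neutral_contains_not_neutral)
  then obtain y where y: "y \<in> Y'" "wX x * wY y * (\<Prod>(u,v)\<in>T. x + u * y - v) \<noteq> 0"
    by (meson sum.not_neutral_contains_not_neutral)
  then have "\<forall>(u,v)\<in>T. x + u * y \<noteq> v"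
    using \<open>finite T\<close> by auto
  with x(1) y(1) X'(1) Y'(1) show ?thesis by blast
qed

section \<open>Restricted sumsets\<close>

text \<open>
  This supplies the index at which the Nullstellensatz is applied to a \<open>k \<times> l\<close> grid. Were all
  coefficients in the admissible range zero, too few others would remain for the multiplicity
  \<open>|{v. (1, v) \<in> T}|\<close> of the root \<open>-1\<close>.
\<close>

lemma exists_nonzero_coeff_in_window:
  fixes T :: "('a::field \<times> 'a) set"
  assumes "finite T" and nz: "0 \<notin> fst ` T"
    and "0 < k" "0 < l"
    and char: "CHAR('a) = 0 \<or> card {v. (1, v) \<in> T} < CHAR('a)"
    and many: "2 * card T + 2 \<le> k + l + card {v. (1, v) \<in> T}"
  shows "\<exists>i\<le>card T. i < k \<and> card T - i < l \<and> coeff (\<Prod>(u,v)\<in>T. [:u, 1:]) i \<noteq> 0"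
proof (rule ccontr)
  define Q where "Q = (\<Prod>(u,v)\<in>T. [:u, 1:])"
  define d where "d = card T"
  define M where "M = card {v. (1, v) \<in> T}"
  assume "\<not> ?thesis"
  then have zero: "coeff Q i = 0" if "i \<le> d" "i < k" "d - i < l" for i
    using that by (auto simp: Q_def d_def)
  \<comment> \<open>The extreme coefficients are nonzero, so the range of vanishing ones meets neither end.\<close>
  have deg: "degree Q = d"
    unfolding Q_def d_def by (subst degree_prod_eq_sum_degree) (auto simp: case_prod_beta)
  have "lead_coeff Q = 1"
    unfolding Q_def by (subst lead_coeff_prod) (auto simp: case_prod_beta intro: prod.neutral)
  with zero[of d] deg \<open>0 < l\<close> have "k \<le> d" by fastforce
  have "coeff Q 0 \<noteq> 0"
    using nz \<open>finite T\<close> by (force simp: Q_def poly_prod case_prod_beta simp flip: poly_0_coeff_0)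
  with zero[of 0] \<open>0 < k\<close> have "l \<le> d" by fastforce

  \<comment> \<open>The factors with \<open>u = 1\<close> are exactly the ones that vanish at \<open>-1\<close>.\<close>
  define T1 where "T1 = Pair (1::'a) ` {v. (1, v) \<in> T}"
  have T1: "T1 \<subseteq> T" "card T1 = M"
    by (auto simp: T1_def M_def card_image inj_on_def)
  define R where "R = (\<Prod>(u,v)\<in>T - T1. [:u, 1:])"
  have "(\<Prod>(u,v)\<in>T1. [:u, 1:]) = (\<Prod>p\<in>T1. [:- (- 1::'a), 1:])"
    by (rule prod.cong) (auto simp: T1_def)
  then have Q: "Q = [:- (- 1), 1:] ^ M * R"
    unfolding Q_def R_def using T1(2)
    by (subst prod.subset_diff[OF T1(1) \<open>finite T\<close>]) (simp add: mult.commute)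
  have "poly R (- 1) \<noteq> 0"
    using \<open>finite T\<close> by (auto simp: R_def poly_prod T1_def)
  from card_support_gt_multiplicity[OF _ this, of M] char
  have "M < card {i. coeff Q i \<noteq> 0}"
    unfolding Q M_def by simp
  also have "\<dots> \<le> card ({..d} - {Suc d - l..<k})"
  proof (rule card_mono)
    show "{i. coeff Q i \<noteq> 0} \<subseteq> {..d} - {Suc d - l..<k}"
    proof
      fix i assume i: "i \<in> {i. coeff Q i \<noteq> 0}"
      then have "i \<le> d" using deg le_degree by blast
      moreover have "\<not> (Suc d - l \<le> i \<and> i < k)"
      proof
        assume "Suc d - l \<le> i \<and> i < k"
        moreover from this have "d - i < l" using \<open>0 < l\<close> by linarith
        ultimately show False using zero[of i] \<open>i \<le> d\<close> i by simp
      qed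
      ultimately show "i \<in> {..d} - {Suc d - l..<k}" by auto
    qed
  qed simp
  also have "\<dots> = Suc d - (k - (Suc d - l))"
    using \<open>k \<le> d\<close> by (subst card_Diff_subset) auto
  finally show False
    using many \<open>k \<le> d\<close> \<open>l \<le> d\<close> \<open>0 < l\<close> by (simp add: M_def[symmetric] d_def[symmetric])
qed

theorem corollary3:
  fixes A B :: "'a::field set" and S :: "('a \<times> 'a) set"
  assumes "finite A" and "A \<noteq> {}"
    and "finite B" and "B \<noteq> {}"
    and "finite S" and "S \<noteq> {}"
    and "S \<subseteq> (UNIV - {0}) \<times> UNIV"
  shows "ereal (real (card {a + b | a b. a \<in> A \<and> b \<in> B \<and> (\<forall>(u, v) \<in> S. a + u * b \<noteq> v)}))
    \<ge> min (field_char TYPE('a) - ereal (real (card {v. (1, v) \<in> S})))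
          (ereal (real (card A) + real (card B) - 2 * real (card S) - 1))"
proof (rule ccontr)
  define C where "C = {a + b | a b. a \<in> A \<and> b \<in> B \<and> (\<forall>(u, v) \<in> S. a + u * b \<noteq> v)}"
  define V where "V = {v. (1, v) \<in> S}"
  assume "\<not> ?thesis"
  then have lt: "ereal (real (card C)) < field_char TYPE('a) - ereal (real (card V))"
      "real (card C) < real (card A) + real (card B) - 2 * real (card S) - 1"
    by (auto simp: C_def V_def not_le)
  have char: "CHAR('a) = 0 \<or> card V + card C < CHAR('a)"
    using lt(1) by (auto simp: field_char_def split: if_splits)
  have small: "card C + 2 * card S + 2 \<le> card A + card B"
    using lt(2) by linarith

  have "C \<subseteq> (\<lambda>(a, b). a + b) ` (A \<times> B)" by (auto simp: C_def)
  then have finC: "finite C"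
    using assms(1,3) by (meson finite_SigmaI finite_imageI finite_subset)
  have "V \<subseteq> snd ` S" by (force simp: V_def)
  then have finV: "finite V" using assms(5) finite_subset by blast
  have disj: "V \<inter> C = {}" by (fastforce simp: V_def C_def)

  define T where "T = S \<union> Pair 1 ` C"
  have "S \<inter> Pair 1 ` C = {}" using disj by (auto simp: V_def)
  then have cardT: "card T = card S + card C"
    unfolding T_def using assms(5) finC by (simp add: card_Un_disjoint card_image inj_on_def)
  have "{v. (1, v) \<in> T} = V \<union> C" by (auto simp: T_def V_def)
  then have card1: "card {v. (1, v) \<in> T} = card V + card C"
    using finV finC disj by (simp add: card_Un_disjoint)
  have finT: "finite T" using assms(5) finC by (simp add: T_def)
  have "0 \<notin> fst ` T"
    using assms(7) by (auto simp: T_def)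
  from exists_nonzero_coeff_in_window[OF finT this, where k = "card A" and l = "card B"]
  obtain i where "i \<le> card T" "i < card A" "card T - i < card B"
      "coeff (\<Prod>(u,v)\<in>T. [:u, 1:]) i \<noteq> 0"
    using char small assms(1-4) by (auto simp: card1 cardT card_gt_0_iff)
  with exists_point_avoiding_lines[OF finT, of i "card T - i" A B]
  obtain a b where ab: "a \<in> A" "b \<in> B" "\<forall>(u,v)\<in>T. a + u * b \<noteq> v"
    by auto
  from ab(3) have "\<forall>(u,v)\<in>S. a + u * b \<noteq> v" by (simp add: T_def ball_Un)
  with ab(1,2) have "a + b \<in> C" unfolding C_def by blast
  then have "(1, a + b) \<in> T" by (simp add: T_def)
  with ab(3) show False by fastforce
qed

end
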